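(* Let $G$ be a connected graph with $n\ge 3$ vertices and $m$ edges, and let $\mathrm{leaf}(G)=\{v\in V(G)\mid \deg_G(v)=1\}$. Then $$2|\mathrm{leaf}(G)|\le \gamma_{tc}(M(G))\le n+m-1.$$
   Context: All graphs are finite, simple and undirected. For a graph $H$, a set $D\subseteq V(H)$ is a total dominating set if every vertex of $H$ has a neighbor in $D$. A set $D\subseteq V(H)$ is a total outer-connected dominating set of $H$ if $D$ is a total dominating set and the induced subgraph $H[V(H)\setminus D]$ is connected; $\gamma_{tc}(H)$ denotes the minimum cardinality of a total outer-connected dominating set of $H$. The middle graph $M(G)$ of a graph $G$ has vertex set $V(G)\cup E(G)$, where two elements $x,y$ are adjacent iff either $x,y\in E(G)$ are edges of $G$ sharing an endpoint, or one of them is a vertex of $G$ and the other is an edge of $G$ incident to it. *)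

theory Defs
  imports "Graph_Theory.Digraph_Component"
begin

text \<open>
  A finite simple undirected graph is a \<^locale>\<open>pair_graph\<close>: a finite, loop-free, symmetric
  digraph without parallel arcs. Every undirected edge is represented by two opposite arcs, so the
  edges proper are the two-element sets of endpoints.
\<close>

definition edge_set :: "'a pair_pre_digraph \<Rightarrow> 'a set set" where
  "edge_set G = {{u, v} | u v. (u, v) \<in> parcs G}"

text \<open>In a symmetric digraph the out-degree is the degree of the undirected graph.\<close>

definition leaf :: "'a pair_pre_digraph \<Rightarrow> 'a set" where
  "leaf G = {v \<in> pverts G. out_degree G v = 1}"

definition middle_graph :: "'a pair_pre_digraph \<Rightarrow> ('a + 'a set) pair_pre_digraph" where
  "middle_graph G =
    \<lparr> pverts = pverts G <+> edge_set G,
      parcs =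
        {(Inr e, Inr f) | e f. e \<in> edge_set G \<and> f \<in> edge_set G \<and> e \<noteq> f \<and> e \<inter> f \<noteq> {}} \<union>
        {(Inl v, Inr e) | v e. v \<in> pverts G \<and> e \<in> edge_set G \<and> v \<in> e} \<union>
        {(Inr e, Inl v) | v e. v \<in> pverts G \<and> e \<in> edge_set G \<and> v \<in> e} \<rparr>"

definition total_dominating_set :: "'a pair_pre_digraph \<Rightarrow> 'a set \<Rightarrow> bool" where
  "total_dominating_set H D \<longleftrightarrow>
    D \<subseteq> pverts H \<and> (\<forall>v \<in> pverts H. \<exists>u \<in> D. (v, u) \<in> parcs H)"

text \<open>
  The library's \<^const>\<open>connected\<close> excludes the graph without vertices, so the full vertex set is
  not total outer-connected dominating.
\<close>

definition total_outer_connected_dominating_set :: "'a pair_pre_digraph \<Rightarrow> 'a set \<Rightarrow> bool" where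
  "total_outer_connected_dominating_set H D \<longleftrightarrow>
    total_dominating_set H D \<and> connected (with_proj H \<restriction> (pverts H - D))"

text \<open>
  Meaningful only if a total outer-connected dominating set exists; otherwise this is the
  unspecified minimum of the empty set.
\<close>

definition gamma_tc :: "'a pair_pre_digraph \<Rightarrow> nat" where
  "gamma_tc H = Min (card ` {D. total_outer_connected_dominating_set H D})"

lemma finite_edge_set:
  assumes "pair_graph G"
  shows "finite (edge_set G)"
proof -
  interpret pair_graph G by fact
  have "edge_set G = (\<lambda>(u, v). {u, v}) ` parcs G"
    by (auto simp: edge_set_def)
  then show ?thesis
    using pair_finite_arcs by simp
qed

lemma pair_graph_middle_graph:
  assumes "pair_graph G"
  shows "pair_graph (middle_graph G)"
proof -
  interpret pair_graph G by fact
  let ?V = "pverts (middle_graph G)" and ?A = "parcs (middle_graph G)"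
  have V: "finite ?V"
    using pair_finite_verts finite_edge_set[OF assms] by (simp add: middle_graph_def)
  have sub: "?A \<subseteq> ?V \<times> ?V"
    by (auto simp: middle_graph_def)
  have A: "finite ?A"
    by (rule finite_subset[OF sub]) (simp add: V)
  have sym: "sym ?A"
    by (rule symI) (auto simp: middle_graph_def)
  show ?thesis
    using V A sub sym
    by unfold_locales (auto simp: symmetric_def, auto simp: middle_graph_def)
qed

end

theory Submission
  imports Defs
begin

text \<open>
  Deleting a single original vertex from \<open>M(G)\<close> leaves a total dominating set with a one-vertex
  complement, which gives the upper bound. For the lower bound, let \<open>v\<close> be a leaf of \<open>G\<close> with edge
  \<open>e\<close>. In \<open>M(G)\<close> the only neighbour of \<open>v\<close> is \<open>e\<close>, so every total outer-connected dominating set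
  \<open>D\<close> contains \<open>e\<close>. If \<open>v\<close> is missing from \<open>D\<close>, then \<open>v\<close> is isolated in the complement, so the
  complement is \<open>{v}\<close> and \<open>card D = n + m - 1\<close>. Otherwise \<open>D\<close> contains all leaves and all
  leaf edges. Since two leaves are never adjacent when \<open>n \<ge> 3\<close>, distinct leaves have distinct
  edges and some vertex is not a leaf, so both cases yield the bound.
\<close>

text \<open>Induction along a path from \<open>x\<close> in the symmetric closure: no step leaves
  \<open>S\<close>. The closure condition is an equivalence because arcs may be traversed in either
  direction. With a small \<open>S\<close>, connectedness thus bounds the whole vertex set.\<close>

lemma connected_closed_verts_subset:
  assumes "connected G" and "x \<in> S" "x \<in> verts G"
    and closed: "\<And>a. a \<in> arcs G \<Longrightarrow> tail G a \<in> S \<longleftrightarrow> head G a \<in> S"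
  shows "verts G \<subseteq> S"
proof
  fix y assume "y \<in> verts G"
  with assms(1,3) have "(x, y) \<in> rtrancl_on (verts G) (parcs (mk_symmetric G))"
    by (auto simp: connected_def strongly_connected_def reachable_def)
  then show "y \<in> S"
  proof (induction rule: rtrancl_on_induct)
    case base
    show ?case by fact
  next
    case (step b c)
    then show ?case using closed by (auto simp: parcs_mk_symmetric)
  qed
qed

lemma connected_single_vertex:
  assumes "verts G = {v}"
  shows "connected G"
  using assms by (auto simp: connected_def strongly_connected_def reachable_def)

lemma pair_graph_arc_sym_iff:
  assumes "pair_graph G"
  shows "(u, v) \<in> parcs G \<longleftrightarrow> (v, u) \<in> parcs G"
proof -
  interpret pair_graph G by fact
  show ?thesis using arcs_symmetric by blast
qed

lemma leafE:
  assumes "v \<in> leaf G"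
  obtains w where "\<And>u. (v, u) \<in> parcs G \<longleftrightarrow> u = w"
proof -
  have "card {a \<in> parcs G. fst a = v} = 1"
    using assms by (simp add: leaf_def out_degree_def out_arcs_def)
  then obtain a where a: "{a \<in> parcs G. fst a = v} = {a}"
    by (auto simp: card_1_singleton_iff)
  have "(v, u) \<in> parcs G \<longleftrightarrow> u = snd a" for u
    using a by (metis (mono_tags, lifting) fst_conv mem_Collect_eq prod.collapse singletonD singletonI snd_conv)
  then show ?thesis by (rule that)
qed

text \<open>By symmetry the only arcs at \<open>v\<close> are \<open>(v, w)\<close> and
  \<open>(w, v)\<close>, which represent the same edge. Hence \<open>Inl v\<close> has just one
  neighbour in the middle graph.\<close>

lemma edge_containing_leaf:
  assumes "pair_graph G" and "\<And>u. (v, u) \<in> parcs G \<longleftrightarrow> u = w"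
  shows "e \<in> edge_set G \<and> v \<in> e \<longleftrightarrow> e = {v, w}"
proof -
  have "(u, v) \<in> parcs G \<longleftrightarrow> u = w" for u
    using assms(2) pair_graph_arc_sym_iff[OF assms(1)] by blast
  with assms(2) show ?thesis by (auto simp: edge_set_def insert_commute)
qed

text \<open>Two adjacent leaves would be closed under arcs, so by connectedness they would be all of
  \<open>G\<close>, which has at least three vertices.\<close>

lemma leaf_neighbour_not_leaf:
  assumes "pair_graph G" "connected (with_proj G)" "card (pverts G) \<ge> 3"
    and "v \<in> leaf G" "(v, w) \<in> parcs G"
  shows "w \<notin> leaf G"
proof
  assume "w \<in> leaf G"
  then obtain x where x: "\<And>u. (w, u) \<in> parcs G \<longleftrightarrow> u = x" using leafE by metis
  obtain y where y: "\<And>u. (v, u) \<in> parcs G \<longleftrightarrow> u = y" using leafE assms(4) by metis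
  note sym = pair_graph_arc_sym_iff[OF assms(1)]
  have "y = w" using assms(5) y[of w] by simp
  moreover have "x = v" using assms(5) x[of v] sym[of v w] by simp
  ultimately have out: "(v, u) \<in> parcs G \<longleftrightarrow> u = w" "(w, u) \<in> parcs G \<longleftrightarrow> u = v" for u
    using x y by auto
  then have "(u, v) \<in> parcs G \<longleftrightarrow> u = w" "(u, w) \<in> parcs G \<longleftrightarrow> u = v" for u
    using sym by blast+
  with out have "verts (with_proj G) \<subseteq> {v, w}"
    using assms(4)
    by (intro connected_closed_verts_subset[OF assms(2), of v]) (auto simp: leaf_def)
  then have "pverts G \<subseteq> {v, w}" by simp
  then have "card (pverts G) \<le> card {v, w}" by (intro card_mono) auto
  also have "\<dots> \<le> 2" by (simp add: card_insert_if)
  finally show False using assms(3) by simp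
qed

lemma connected_has_neighbour:
  assumes "pair_graph G" "connected (with_proj G)" "card (pverts G) \<ge> 2" "v \<in> pverts G"
  obtains w where "(v, w) \<in> parcs G"
proof -
  note sym = pair_graph_arc_sym_iff[OF assms(1)]
  have "\<exists>w. (v, w) \<in> parcs G"
  proof (rule ccontr)
    assume none: "\<nexists>w. (v, w) \<in> parcs G"
    then have "\<nexists>w. (w, v) \<in> parcs G" using sym by blast
    with none have "verts (with_proj G) \<subseteq> {v}"
      using assms(4) by (intro connected_closed_verts_subset[OF assms(2), of v]) auto
    then have "pverts G \<subseteq> {v}" by simp
    then have "card (pverts G) \<le> card {v}" by (intro card_mono) auto
    then show False using assms(3) by simp
  qed
  then show ?thesis using that by blast
qed

lemma card_pverts_middle_graph:
  assumes "pair_graph G"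
  shows "card (pverts (middle_graph G)) = card (pverts G) + card (edge_set G)"
proof -
  interpret pair_graph G by fact
  show ?thesis
    using finite_edge_set[OF assms] pair_finite_verts
    by (simp add: middle_graph_def card_Plus)
qed

lemma middle_graph_arc_Inl_iff:
  "(Inl v, x) \<in> parcs (middle_graph G) \<longleftrightarrow>
    (\<exists>e. x = Inr e \<and> v \<in> pverts G \<and> e \<in> edge_set G \<and> v \<in> e)"
  "(x, Inl v) \<in> parcs (middle_graph G) \<longleftrightarrow>
    (\<exists>e. x = Inr e \<and> v \<in> pverts G \<and> e \<in> edge_set G \<and> v \<in> e)"
  by (auto simp: middle_graph_def)

text \<open>This is the witness for the upper bound. All edges of \<open>G\<close> stay in the set
  and dominate the original vertices; edges are dominated by their endpoints.\<close>

lemma tocd_set_remove_vertex: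
  assumes "pair_graph G" "connected (with_proj G)" "card (pverts G) \<ge> 2" "v \<in> pverts G"
  shows "total_outer_connected_dominating_set (middle_graph G) (pverts (middle_graph G) - {Inl v})"
    (is "total_outer_connected_dominating_set ?M ?D")
proof -
  interpret pair_graph G by fact
  have "\<exists>y \<in> ?D. (x, y) \<in> parcs ?M" if "x \<in> pverts ?M" for x
  proof (cases x)
    case (Inl u)
    with that have u: "u \<in> pverts G" by (auto simp: middle_graph_def)
    then obtain w where "(u, w) \<in> parcs G" using connected_has_neighbour assms(1-3) by metis
    then have "{u, w} \<in> edge_set G" by (auto simp: edge_set_def)
    with u Inl show ?thesis
      by (intro bexI[of _ "Inr {u, w}"]) (auto simp: middle_graph_def)
  next
    case (Inr e)
    with that have e: "e \<in> edge_set G" by (auto simp: middle_graph_def)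
    then obtain a b where ab: "e = {a, b}" "(a, b) \<in> parcs G" by (auto simp: edge_set_def)
    then have "a \<noteq> b" "a \<in> pverts G" "b \<in> pverts G"
      using no_loops' in_arcsD1 in_arcsD2 by auto
    \<comment> \<open>Of the two distinct endpoints of \<open>e\<close>, at least one differs from
      the deleted \<open>v\<close>.\<close>
    then obtain c where "c \<in> e" "c \<noteq> v" "c \<in> pverts G" using ab by blast
    with e Inr show ?thesis
      by (intro bexI[of _ "Inl c"]) (auto simp: middle_graph_def)
  qed
  then have "total_dominating_set ?M ?D"
    unfolding total_dominating_set_def by blast
  moreover have "pverts ?M - ?D = {Inl v}"
    using assms(4) by (auto simp: middle_graph_def)
  then have "connected (with_proj ?M \<restriction> (pverts ?M - ?D))"
    by (intro connected_single_vertex) simp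
  ultimately show ?thesis
    unfolding total_outer_connected_dominating_set_def by blast
qed

lemma tocd_set_missing_leaf:
  assumes "pair_graph G" "total_outer_connected_dominating_set (middle_graph G) D"
    and "v \<in> leaf G" "Inl v \<notin> D"
  shows "D = pverts (middle_graph G) - {Inl v}"
proof -
  let ?M = "middle_graph G" and ?H = "with_proj (middle_graph G) \<restriction> (pverts (middle_graph G) - D)"
  obtain w where w: "\<And>u. (v, u) \<in> parcs G \<longleftrightarrow> u = w" using leafE assms(3) by metis
  note edge = edge_containing_leaf[OF assms(1) w]
  have v: "Inl v \<in> pverts ?M" using assms(3) by (auto simp: leaf_def middle_graph_def)
  have D: "D \<subseteq> pverts ?M" "connected ?H" "\<exists>y \<in> D. (Inl v, y) \<in> parcs ?M"
    using assms(2) v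
    by (auto simp: total_outer_connected_dominating_set_def total_dominating_set_def)
  have arc: "x = Inr {v, w}" if "(Inl v, x) \<in> parcs ?M \<or> (x, Inl v) \<in> parcs ?M" for x
    using that edge by (auto simp: middle_graph_arc_Inl_iff)
  then have nb_in_D: "Inr {v, w} \<in> D" using D(3) by blast
  \<comment> \<open>Every neighbour of \<open>Inl v\<close> lies in \<open>D\<close>, so no arc of
    the complement touches \<open>Inl v\<close> and both sides of the closure condition are
    false.\<close>
  have "verts ?H \<subseteq> {Inl v}"
  proof (rule connected_closed_verts_subset[OF D(2), of "Inl v"])
    fix a assume a: "a \<in> arcs ?H"
    obtain x y where xy: "a = (x, y)" by fastforce
    with a have "(x, y) \<in> parcs ?M" "x \<notin> D" "y \<notin> D" by auto
    then have "x \<noteq> Inl v" "y \<noteq> Inl v" using arc nb_in_D by blast+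
    with xy show "tail ?H a \<in> {Inl v} \<longleftrightarrow> head ?H a \<in> {Inl v}" by simp
  qed (use v assms(4) in simp_all)
  then show ?thesis using D(1) assms(4) by auto
qed

lemma two_card_leaf_le_tocd_set:
  assumes "pair_graph G" "connected (with_proj G)" "card (pverts G) \<ge> 3"
    and D: "total_outer_connected_dominating_set (middle_graph G) D"
  shows "2 * card (leaf G) \<le> card D"
proof -
  interpret pair_graph G by fact
  let ?M = "middle_graph G"
  have fin_leaf: "finite (leaf G)" using pair_finite_verts by (simp add: leaf_def)
  have dom: "D \<subseteq> pverts ?M" "\<And>v. v \<in> pverts ?M \<Longrightarrow> \<exists>u \<in> D. (v, u) \<in> parcs ?M"
    using D by (auto simp: total_outer_connected_dominating_set_def total_dominating_set_def)
  have fin_M: "finite (pverts ?M)"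
    using pair_finite_verts finite_edge_set[OF assms(1)] by (simp add: middle_graph_def)
  then have fin_D: "finite D" using dom(1) finite_subset by blast
  have "\<forall>v \<in> leaf G. \<exists>w. \<forall>u. (v, u) \<in> parcs G \<longleftrightarrow> u = w" using leafE by metis
  then obtain nb where nb: "\<And>v u. v \<in> leaf G \<Longrightarrow> (v, u) \<in> parcs G \<longleftrightarrow> u = nb v" by metis
  \<comment> \<open>The pendant edge at a leaf \<open>v\<close>; \<open>nb\<close> is specified on
    leaves only.\<close>
  define pend where "pend v = {v, nb v}" for v
  have not_leaf: "nb v \<notin> leaf G" if "v \<in> leaf G" for v
    using leaf_neighbour_not_leaf[OF assms(1-3)] nb that by blast
  \<comment> \<open>If distinct leaves shared an edge, each would be the neighbour of the other,
    contradicting \<open>not_leaf\<close>.\<close>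
  have inj: "inj_on pend (leaf G)"
    using not_leaf by (auto simp: inj_on_def pend_def doubleton_eq_iff)
  have pend: "e \<in> edge_set G \<and> v \<in> e \<longleftrightarrow> e = pend v" if "v \<in> leaf G" for v e
    unfolding pend_def using edge_containing_leaf[OF assms(1) nb[OF that]] .
  show ?thesis
  proof (cases "Inl ` leaf G \<subseteq> D")
    case True
    \<comment> \<open>Domination is total: even with \<open>Inl v\<close> in \<open>D\<close>, its
      only neighbour must be in \<open>D\<close> as well.\<close>
    have "Inr (pend v) \<in> D" if "v \<in> leaf G" for v
      using dom(2)[of "Inl v"] pend[OF that] that
      by (auto simp: middle_graph_arc_Inl_iff leaf_def middle_graph_def)
    then have "leaf G <+> pend ` leaf G \<subseteq> D" using True by auto
    then have "card (leaf G <+> pend ` leaf G) \<le> card D" using fin_D by (rule card_mono[rotated])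
    then show ?thesis using fin_leaf inj by (simp add: card_Plus card_image)
  next
    case False
    then obtain v where v: "v \<in> leaf G" "Inl v \<notin> D" by blast
    then have "D = pverts ?M - {Inl v}" using tocd_set_missing_leaf[OF assms(1) D] by blast
    moreover have "Inl v \<in> pverts ?M" using v by (auto simp: leaf_def middle_graph_def)
    ultimately have card_D: "card D = card (pverts G) + card (edge_set G) - 1"
      using card_pverts_middle_graph[OF assms(1)] fin_M by simp
    \<comment> \<open>The non-leaf \<open>nb v\<close> makes the leaf count strictly smaller than
      the number of vertices, which compensates for the \<open>- 1\<close> in
      \<open>card_D\<close>.\<close>
    have "nb v \<in> pverts G" using nb[OF v(1)] in_arcsD2 by blast
    then have "leaf G \<subset> pverts G" using not_leaf[OF v(1)] by (auto simp: leaf_def)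
    then have "card (leaf G) < card (pverts G)" using pair_finite_verts by (rule psubset_card_mono[rotated])
    moreover have "card (pend ` leaf G) \<le> card (edge_set G)"
      using pend finite_edge_set[OF assms(1)] by (intro card_mono) auto
    ultimately show ?thesis using card_D card_image[OF inj] by linarith
  qed
qed

theorem theorem2p2:
  fixes G :: "'a pair_pre_digraph" and n m :: nat
  assumes "pair_graph G"
    and "connected (with_proj G)"
    and "card (pverts G) = n"
    and "n \<ge> 3"
    and "card (edge_set G) = m"
  shows "2 * card (leaf G) \<le> gamma_tc (middle_graph G) \<and>
         gamma_tc (middle_graph G) \<le> n + m - 1"
proof -
  interpret pair_graph G by fact
  let ?M = "middle_graph G"
  let ?\<D> = "{D. total_outer_connected_dominating_set ?M D}"
  have fin_M: "finite (pverts ?M)"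
    using pair_finite_verts finite_edge_set[OF assms(1)] by (simp add: middle_graph_def)
  have "?\<D> \<subseteq> Pow (pverts ?M)"
    by (auto simp: total_outer_connected_dominating_set_def total_dominating_set_def)
  then have fin: "finite (card ` ?\<D>)" using fin_M by (meson finite_Pow_iff finite_imageI finite_subset)
  obtain v where v: "v \<in> pverts G" using assms(3,4) by fastforce
  \<comment> \<open>This set serves twice: its size gives the upper bound, and its existence ensures
    that the minimum is attained, as the lower bound requires.\<close>
  have D: "pverts ?M - {Inl v} \<in> ?\<D>"
    using tocd_set_remove_vertex[OF assms(1,2) _ v] assms(3,4) by simp
  have "card (pverts ?M - {Inl v}) = n + m - 1"
    using v fin_M card_pverts_middle_graph[OF assms(1)] assms(3,5)
    by (subst card_Diff_singleton) (auto simp: middle_graph_def)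
  then have upper: "gamma_tc ?M \<le> n + m - 1"
    unfolding gamma_tc_def using D fin by (metis Min_le imageI)
  have "gamma_tc ?M \<in> card ` ?\<D>"
    unfolding gamma_tc_def using D fin by (intro Min_in) auto
  then have "2 * card (leaf G) \<le> gamma_tc ?M"
    using two_card_leaf_le_tocd_set[OF assms(1,2)] assms(3,4) by auto
  with upper show ?thesis by blast
qed

end
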